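(* Let $P_1, P_2 \in \mathcal{P}_{\mathrm{reach}}$. Then $P_1 \sim_{\rm FB:ps} P_2$ if and only if $\mathcal{A}_{\rm F} \vdash P_1 = P_2$.
   Context: Fix a countable set $A$ of actions containing an unobservable action $\tau$. Process terms are generated by $P ::= \mathbf{0} \mid a\,.\,P \mid a^{\dagger}.\,P \mid P + P \mid P \parallel_L P$ with $a \in A$ and $L \subseteq A \setminus \{\tau\}$; $a^\dagger$ marks an already executed action, and $P_1 \parallel_L P_2$ is CSP-style parallel composition. The predicate $\mathrm{initial}$ is the least one with: $\mathrm{initial}(\mathbf{0})$; $\mathrm{initial}(a.P)$ if $\mathrm{initial}(P)$; $\mathrm{initial}(P_1+P_2)$ and $\mathrm{initial}(P_1 \parallel_L P_2)$ if $\mathrm{initial}(P_1)\wedge \mathrm{initial}(P_2)$. The predicate $\mathrm{wf}$ is the least one with: $\mathrm{wf}(\mathbf{0})$; $\mathrm{wf}(a.P)$ if $\mathrm{initial}(P)$; $\mathrm{wf}(a^\dagger.P)$ if $\mathrm{wf}(P)$; $\mathrm{wf}(P_1+P_2)$ if $(\mathrm{wf}(P_1)\wedge\mathrm{initial}(P_2))\vee(\mathrm{initial}(P_1)\wedge\mathrm{wf}(P_2))$; $\mathrm{wf}(P_1\parallel_L P_2)$ if $\mathrm{wf}(P_1)\wedge\mathrm{wf}(P_2)$. Proof terms: $\theta ::= a \mid .\theta \mid +_l\theta \mid +_r\theta \mid \parallel_l\theta \mid \parallel_r\theta \mid \langle\theta,\theta\rangle$, with partial function $\mathrm{act}$: $\mathrm{act}(a)=a$;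 $\mathrm{act}$ of $.\theta$, $+_l\theta$, $+_r\theta$, $\parallel_l\theta$, $\parallel_r\theta$ is $\mathrm{act}(\theta)$; $\mathrm{act}(\langle\theta_1,\theta_2\rangle)=\mathrm{act}(\theta_1)$ if $\mathrm{act}(\theta_1)=\mathrm{act}(\theta_2)$. The transition relation is the least one closed under: $a.P \xrightarrow{a} a^\dagger.P$ if $\mathrm{initial}(P)$; $a^\dagger.P \xrightarrow{.\theta} a^\dagger.P'$ if $P\xrightarrow{\theta}P'$; $P_1+P_2\xrightarrow{+_l\theta}P_1'+P_2$ if $P_1\xrightarrow{\theta}P_1'$ and $\mathrm{initial}(P_2)$; $P_1+P_2\xrightarrow{+_r\theta}P_1+P_2'$ if $P_2\xrightarrow{\theta}P_2'$ and $\mathrm{initial}(P_1)$; $P_1\parallel_L P_2\xrightarrow{\parallel_l\theta}P_1'\parallel_L P_2$ if $P_1\xrightarrow{\theta}P_1'$ and $\mathrm{act}(\theta)\notin L$; $P_1\parallel_L P_2\xrightarrow{\parallel_r\theta}P_1\parallel_L P_2'$ if $P_2\xrightarrow{\theta}P_2'$ and $\mathrm{act}(\theta)\notin L$; $P_1\parallel_L P_2\xrightarrow{\langle\theta_1,\theta_2\rangle}P_1'\parallel_L P_2'$ if $P_1\xrightarrow{\theta_1}P_1'$, $P_2\xrightarrow{\theta_2}P_2'$ and $\mathrm{act}(\theta_1)=\mathrm{act}(\theta_2)\in L$. $\mathcal{P}_{\mathrm{reach}}$ is the set of processes reachable from some initial process. A relation $\mathcal{B}$ over $\mathcal{P}_{\mathrm{reach}}$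 is a past-sensitive forward bisimulation if it is symmetric and, whenever $(P_1,P_2)\in\mathcal{B}$: $\mathrm{initial}(P_1)\Leftrightarrow\mathrm{initial}(P_2)$, and for each $P_1\xrightarrow{\theta_1}P_1'$ there is $P_2\xrightarrow{\theta_2}P_2'$ with $\mathrm{act}(\theta_1)=\mathrm{act}(\theta_2)$ and $(P_1',P_2')\in\mathcal{B}$. $\sim_{\rm FB:ps}$ is the union of all past-sensitive forward bisimulations. Notation: $\sum_{i\in I} a_i.P_i$ for finite $I$ denotes an alternative composition of the summands (well defined up to the associativity/commutativity axioms below), and is $\mathbf{0}$ when $I=\emptyset$; $[a^\dagger.]\,P$ denotes an optional executed action prefix. Forward normal form: $P$ is in F-nf iff $P = [b^\dagger.]\sum_{i\in I} a_i.P_i$ for a finite $I$, an optional executed prefix $b^\dagger$, and each $P_i$ initial and in F-nf. Axiom system $\mathcal{A}_{\rm F}$ (side conditions ensure both sides are processes in $\mathcal{P}_{\mathrm{reach}}$): (F1) $(P+Q)+R = P+(Q+R)$, where at least two among $P,Q,R$ are initial; (F2) $P+Q = Q+P$, where at least one of $P,Q$ is initial; (F3) $P+\mathbf{0} = P$; (F4) $P+P = P$, where $\mathrm{initial}(P)$; (F5) $a^\dagger.P = b^\dagger.P$ if $\mathrm{initial}(P)$ (for any $a,b\in A$); (F6) $a^\dagger.P = P$ if not $\mathrm{initial}(P)$; (F7) $P+Q = P$ if not $\mathrm{initial}(P)$, where $\mathrm{initial}(Q)$; (F8) (expansion law) for $k\in\{1,2\}$ let $P_k = [a_k^\dagger.]P_k'$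 with $P_k' = \sum_{i\in I_k} a_{k,i}.P_{k,i}$ in F-nf; then $P_1\parallel_L P_2 = [a^\dagger.]\Big(\sum_{i\in I_1, a_{1,i}\notin L} a_{1,i}.(P_{1,i}\parallel_L P_2') + \sum_{i\in I_2, a_{2,i}\notin L} a_{2,i}.(P_1'\parallel_L P_{2,i}) + \sum_{i\in I_1, a_{1,i}\in L}\ \sum_{j\in I_2, a_{2,j}=a_{1,i}} a_{1,i}.(P_{1,i}\parallel_L P_{2,j})\Big)$, where the executed prefix $a^\dagger$ on the right is present iff $a_1^\dagger$ or $a_2^\dagger$ is present. $\mathcal{A}_{\rm F}\vdash P=Q$ means the equation is derivable from instances of these axioms using reflexivity, symmetry, transitivity, and substitutivity with respect to action prefix, executed action prefix, alternative composition and parallel composition. *)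

theory Defs
  imports Main "HOL-Library.Countable"
begin

text \<open>The set of actions is the whole type; it may be the singleton of \<open>tau\<close>.\<close>

class action = countable +
  fixes tau :: 'a

typedef (overloaded) ('a::action) sync = "{L :: 'a set. tau \<notin> L}"
  morphisms sync_set Sync
  by auto

declare [[typedef_overloaded]]

datatype (dead 'a::action) proc =
    Null
  | Prefix 'a "'a proc"
  | Past 'a "'a proc"
  | Choice "'a proc" "'a proc" (infixl \<open>\<oplus>\<close> 65)
  | Par "'a sync" "'a proc" "'a proc"

inductive initial :: "'a::action proc \<Rightarrow> bool" where
  "initial Null"
| "initial P \<Longrightarrow> initial (Prefix a P)"
| "initial P\<^sub>1 \<Longrightarrow> initial P\<^sub>2 \<Longrightarrow> initial (P\<^sub>1 \<oplus> P\<^sub>2)"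
| "initial P\<^sub>1 \<Longrightarrow> initial P\<^sub>2 \<Longrightarrow> initial (Par L P\<^sub>1 P\<^sub>2)"

datatype 'a pterm =
    Act 'a
  | Dot "'a pterm"
  | ChoiceL "'a pterm"
  | ChoiceR "'a pterm"
  | ParL "'a pterm"
  | ParR "'a pterm"
  | Both "'a pterm" "'a pterm"

text \<open>\<^term>\<open>None\<close> encodes undefinedness.\<close>

fun act :: "'a pterm \<Rightarrow> 'a option" where
  "act (Act a) = Some a"
| "act (Dot \<theta>) = act \<theta>"
| "act (ChoiceL \<theta>) = act \<theta>"
| "act (ChoiceR \<theta>) = act \<theta>"
| "act (ParL \<theta>) = act \<theta>"
| "act (ParR \<theta>) = act \<theta>"
| "act (Both \<theta>\<^sub>1 \<theta>\<^sub>2) = (if act \<theta>\<^sub>1 = act \<theta>\<^sub>2 then act \<theta>\<^sub>1 else None)"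

inductive transition :: "'a::action proc \<Rightarrow> 'a pterm \<Rightarrow> 'a proc \<Rightarrow> bool"
    (\<open>_ \<midarrow>_\<rightarrow> _\<close> [61, 0, 61] 60) where
  "initial P \<Longrightarrow> Prefix a P \<midarrow>Act a\<rightarrow> Past a P"
| "P \<midarrow>\<theta>\<rightarrow> P' \<Longrightarrow> Past a P \<midarrow>Dot \<theta>\<rightarrow> Past a P'"
| "P\<^sub>1 \<midarrow>\<theta>\<rightarrow> P\<^sub>1' \<Longrightarrow> initial P\<^sub>2 \<Longrightarrow> (P\<^sub>1 \<oplus> P\<^sub>2) \<midarrow>ChoiceL \<theta>\<rightarrow> (P\<^sub>1' \<oplus> P\<^sub>2)"
| "P\<^sub>2 \<midarrow>\<theta>\<rightarrow> P\<^sub>2' \<Longrightarrow> initial P\<^sub>1 \<Longrightarrow> (P\<^sub>1 \<oplus> P\<^sub>2) \<midarrow>ChoiceR \<theta>\<rightarrow> (P\<^sub>1 \<oplus> P\<^sub>2')"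
| "P\<^sub>1 \<midarrow>\<theta>\<rightarrow> P\<^sub>1' \<Longrightarrow> act \<theta> = Some a \<Longrightarrow> a \<notin> sync_set L \<Longrightarrow>
     Par L P\<^sub>1 P\<^sub>2 \<midarrow>ParL \<theta>\<rightarrow> Par L P\<^sub>1' P\<^sub>2"
| "P\<^sub>2 \<midarrow>\<theta>\<rightarrow> P\<^sub>2' \<Longrightarrow> act \<theta> = Some a \<Longrightarrow> a \<notin> sync_set L \<Longrightarrow>
     Par L P\<^sub>1 P\<^sub>2 \<midarrow>ParR \<theta>\<rightarrow> Par L P\<^sub>1 P\<^sub>2'"
| "P\<^sub>1 \<midarrow>\<theta>\<^sub>1\<rightarrow> P\<^sub>1' \<Longrightarrow> P\<^sub>2 \<midarrow>\<theta>\<^sub>2\<rightarrow> P\<^sub>2' \<Longrightarrow>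
     act \<theta>\<^sub>1 = Some a \<Longrightarrow> act \<theta>\<^sub>2 = Some a \<Longrightarrow> a \<in> sync_set L \<Longrightarrow>
     Par L P\<^sub>1 P\<^sub>2 \<midarrow>Both \<theta>\<^sub>1 \<theta>\<^sub>2\<rightarrow> Par L P\<^sub>1' P\<^sub>2'"

definition reach :: "'a::action proc set" where
  "reach = {P. \<exists>P\<^sub>0. initial P\<^sub>0 \<and> (\<lambda>Q Q'. \<exists>\<theta>. Q \<midarrow>\<theta>\<rightarrow> Q')\<^sup>*\<^sup>* P\<^sub>0 P}"

definition ps_forward_bisim :: "('a::action proc \<times> 'a proc) set \<Rightarrow> bool" where
  "ps_forward_bisim B \<longleftrightarrow>
     B \<subseteq> reach \<times> reach \<and> sym B \<and>
     (\<forall>(P\<^sub>1, P\<^sub>2) \<in> B.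
        (initial P\<^sub>1 \<longleftrightarrow> initial P\<^sub>2) \<and>
        (\<forall>\<theta>\<^sub>1 P\<^sub>1'. P\<^sub>1 \<midarrow>\<theta>\<^sub>1\<rightarrow> P\<^sub>1' \<longrightarrow>
           (\<exists>\<theta>\<^sub>2 P\<^sub>2'. P\<^sub>2 \<midarrow>\<theta>\<^sub>2\<rightarrow> P\<^sub>2' \<and> act \<theta>\<^sub>1 = act \<theta>\<^sub>2 \<and> (P\<^sub>1', P\<^sub>2') \<in> B)))"

definition FB_ps :: "('a::action proc \<times> 'a proc) set" where
  "FB_ps = \<Union> {B. ps_forward_bisim B}"

text \<open>\<open>altcomp I f S\<close>: the term \<open>S\<close> is an alternative composition, in some order and with some
  bracketing, of the summands \<open>f i\<close> for \<open>i\<close> in the (necessarily finite) set \<open>I\<close>. Since the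
  notation $\sum_{i\in I}$ is only determined up to associativity and commutativity, it is
  a relation and not a function.\<close>

inductive altcomp :: "'i set \<Rightarrow> ('i \<Rightarrow> 'a::action proc) \<Rightarrow> 'a proc \<Rightarrow> bool" where
  "altcomp {} f Null"
| "altcomp {i} f (f i)"
| "altcomp I f S \<Longrightarrow> altcomp J f T \<Longrightarrow> I \<noteq> {} \<Longrightarrow> J \<noteq> {} \<Longrightarrow> I \<inter> J = {} \<Longrightarrow>
     altcomp (I \<union> J) f (S \<oplus> T)"

fun opt_past :: "'a option \<Rightarrow> 'a::action proc \<Rightarrow> 'a proc" where
  "opt_past None P = P"
| "opt_past (Some a) P = Past a P"

inductive F_nf :: "'a::action proc \<Rightarrow> bool" where
  "altcomp I (\<lambda>i::nat. Prefix (a i) (P i)) S \<Longrightarrow>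
   (\<And>i. i \<in> I \<Longrightarrow> initial (P i)) \<Longrightarrow> (\<And>i. i \<in> I \<Longrightarrow> F_nf (P i)) \<Longrightarrow>
   F_nf (opt_past b S)"

inductive axiom_F :: "'a::action proc \<Rightarrow> 'a proc \<Rightarrow> bool" where
  F1: "initial P \<and> initial Q \<or> initial P \<and> initial R \<or> initial Q \<and> initial R \<Longrightarrow>
       axiom_F ((P \<oplus> Q) \<oplus> R) (P \<oplus> (Q \<oplus> R))"
| F2: "initial P \<or> initial Q \<Longrightarrow> axiom_F (P \<oplus> Q) (Q \<oplus> P)"
| F3: "axiom_F (P \<oplus> Null) P"
| F4: "initial P \<Longrightarrow> axiom_F (P \<oplus> P) P"
| F5: "initial P \<Longrightarrow> axiom_F (Past a P) (Past b P)"
| F6: "\<not> initial P \<Longrightarrow> axiom_F (Past a P) P"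
| F7: "\<not> initial P \<Longrightarrow> initial Q \<Longrightarrow> axiom_F (P \<oplus> Q) P"
| F8: "altcomp I\<^sub>1 (\<lambda>i::nat. Prefix (a\<^sub>1 i) (P\<^sub>1 i)) S\<^sub>1 \<Longrightarrow> F_nf S\<^sub>1 \<Longrightarrow>
       altcomp I\<^sub>2 (\<lambda>i::nat. Prefix (a\<^sub>2 i) (P\<^sub>2 i)) S\<^sub>2 \<Longrightarrow> F_nf S\<^sub>2 \<Longrightarrow>
       altcomp {i \<in> I\<^sub>1. a\<^sub>1 i \<notin> sync_set L} (\<lambda>i. Prefix (a\<^sub>1 i) (Par L (P\<^sub>1 i) S\<^sub>2)) T\<^sub>1 \<Longrightarrow>
       altcomp {i \<in> I\<^sub>2. a\<^sub>2 i \<notin> sync_set L} (\<lambda>i. Prefix (a\<^sub>2 i) (Par L S\<^sub>1 (P\<^sub>2 i))) T\<^sub>2 \<Longrightarrow>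
       altcomp {(i, j). i \<in> I\<^sub>1 \<and> a\<^sub>1 i \<in> sync_set L \<and> j \<in> I\<^sub>2 \<and> a\<^sub>2 j = a\<^sub>1 i}
         (\<lambda>(i, j). Prefix (a\<^sub>1 i) (Par L (P\<^sub>1 i) (P\<^sub>2 j))) T\<^sub>3 \<Longrightarrow>
       (b \<noteq> None \<longleftrightarrow> b\<^sub>1 \<noteq> None \<or> b\<^sub>2 \<noteq> None) \<Longrightarrow>
       axiom_F (Par L (opt_past b\<^sub>1 S\<^sub>1) (opt_past b\<^sub>2 S\<^sub>2)) (opt_past b (T\<^sub>1 \<oplus> T\<^sub>2 \<oplus> T\<^sub>3))"

text \<open>Equations relate reachable processes only, hence the membership premises. They matter
  for parallel composition, as reachability of \<open>Par L P Q\<close> is not determined by that of \<open>P\<close>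
  and \<open>Q\<close>; the axiom \<open>F5\<close>, for instance, does not preserve it in such a context. The
  substitutivity rules for binary operators replace both operands at once.\<close>

inductive derivable_F :: "'a::action proc \<Rightarrow> 'a proc \<Rightarrow> bool" where
  ax: "axiom_F P Q \<Longrightarrow> P \<in> reach \<Longrightarrow> Q \<in> reach \<Longrightarrow> derivable_F P Q"
| refl: "P \<in> reach \<Longrightarrow> derivable_F P P"
| sym: "derivable_F P Q \<Longrightarrow> derivable_F Q P"
| trans: "derivable_F P Q \<Longrightarrow> derivable_F Q R \<Longrightarrow> derivable_F P R"
| prefix: "derivable_F P Q \<Longrightarrow> Prefix a P \<in> reach \<Longrightarrow> Prefix a Q \<in> reach \<Longrightarrow>
     derivable_F (Prefix a P) (Prefix a Q)"
| past: "derivable_F P Q \<Longrightarrow> Past a P \<in> reach \<Longrightarrow> Past a Q \<in> reach \<Longrightarrow>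
     derivable_F (Past a P) (Past a Q)"
| choice: "derivable_F P\<^sub>1 Q\<^sub>1 \<Longrightarrow> derivable_F P\<^sub>2 Q\<^sub>2 \<Longrightarrow>
     P\<^sub>1 \<oplus> P\<^sub>2 \<in> reach \<Longrightarrow> Q\<^sub>1 \<oplus> Q\<^sub>2 \<in> reach \<Longrightarrow> derivable_F (P\<^sub>1 \<oplus> P\<^sub>2) (Q\<^sub>1 \<oplus> Q\<^sub>2)"
| par: "derivable_F P\<^sub>1 Q\<^sub>1 \<Longrightarrow> derivable_F P\<^sub>2 Q\<^sub>2 \<Longrightarrow>
     Par L P\<^sub>1 P\<^sub>2 \<in> reach \<Longrightarrow> Par L Q\<^sub>1 Q\<^sub>2 \<in> reach \<Longrightarrow>
     derivable_F (Par L P\<^sub>1 P\<^sub>2) (Par L Q\<^sub>1 Q\<^sub>2)"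

end

theory Submission
  imports Defs
begin

text \<open>
  Targets of transitions are never initial, so past-sensitive forward bisimilarity amounts to
  ordinary forward bisimilarity together with agreement on being initial. Up to the former, an
  executed prefix and the initial side of a choice whose other side has moved can be discarded;
  this gives soundness.

  For completeness, every reachable process is provably equal to an initial sum of prefixes, put
  under an executed \<open>tau\<close> if the process is not initial. The choice of \<open>tau\<close> matters: as it never
  occurs in a synchronisation set, the parallel composition of two such forms is reachable, so
  both operands of a parallel composition may be normalised at once before expanding. For
  bisimilar sums, each absorbs every summand of the other by induction on size, hence both are
  equal to their common sum.
\<close>

section \<open>Reachable processes\<close>

inductive_simps initial_simps [simp]:
  "initial Null" "initial (Prefix a P)" "initial (Past a P)" "initial (P \<oplus> Q)"
  "initial (Par L P Q)"

lemma initial_opt_past [simp]: "initial (opt_past b P) \<longleftrightarrow> b = None \<and> initial P"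
  by (cases b) auto

lemma transition_not_initial: "P \<midarrow>\<theta>\<rightarrow> P' \<Longrightarrow> \<not> initial P'"
  by (induction rule: transition.induct) auto

lemma transition_act: "P \<midarrow>\<theta>\<rightarrow> P' \<Longrightarrow> \<exists>a. act \<theta> = Some a"
  by (induction rule: transition.induct) auto

lemma reach_initial: "initial P \<Longrightarrow> P \<in> reach"
  by (auto simp: reach_def)

lemma reach_transition: "P \<in> reach \<Longrightarrow> P \<midarrow>\<theta>\<rightarrow> P' \<Longrightarrow> P' \<in> reach"
  unfolding reach_def by (auto intro: rtranclp.rtrancl_into_rtrancl)

lemma reach_induct [consumes 1, case_names initial transition]:
  assumes "P \<in> reach"
    and "\<And>P. initial P \<Longrightarrow> Q P"
    and "\<And>P \<theta> P'. P \<in> reach \<Longrightarrow> Q P \<Longrightarrow> P \<midarrow>\<theta>\<rightarrow> P' \<Longrightarrow> Q P'"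
  shows "Q P"
proof -
  obtain P\<^sub>0 where i: "initial P\<^sub>0" and r: "(\<lambda>Q Q'. \<exists>\<theta>. Q \<midarrow>\<theta>\<rightarrow> Q')\<^sup>*\<^sup>* P\<^sub>0 P"
    using assms(1) by (auto simp: reach_def)
  from r have "P \<in> reach \<and> Q P"
  proof (induction rule: rtranclp_induct)
    case base
    then show ?case using i assms(2) reach_initial by blast
  next
    case (step y z)
    then show ?case using assms(3) reach_transition by blast
  qed
  then show ?thesis by blast
qed

text \<open>A run turns \<open>Prefix\<close> into \<open>Past\<close>, so the conditions for the
  different shapes feed one another and are proved as a single invariant along the run. For
  \<open>Par\<close> the condition is only necessary: with \<open>a\<close> in
  \<open>sync_set L\<close>, the process \<open>Par L (Past a Null) Null\<close> has reachable
  operands but is not reachable.\<close>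

lemma reach_components:
  assumes "P \<in> reach"
  shows "case P of Null \<Rightarrow> True | Prefix a Q \<Rightarrow> initial Q | Past a Q \<Rightarrow> Q \<in> reach
    | Q \<oplus> R \<Rightarrow> Q \<in> reach \<and> initial R \<or> initial Q \<and> R \<in> reach
    | Par L Q R \<Rightarrow> Q \<in> reach \<and> R \<in> reach"
  using assms
proof (induction rule: reach_induct)
  case (initial P)
  then show ?case by (auto simp: reach_initial split: proc.splits)
next
  case (transition P \<theta> P')
  from transition(2,3) show ?case
    by (cases rule: transition.cases)
      (auto intro: reach_transition reach_initial dest: transition_not_initial)
qed

lemma reach_Prefix [simp]: "Prefix a P \<in> reach \<longleftrightarrow> initial P"
  using reach_components[of "Prefix a P"] by (auto intro: reach_initial)

lemma reach_Past [simp]: "Past a P \<in> reach \<longleftrightarrow> P \<in> reach"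
proof
  show "Past a P \<in> reach \<Longrightarrow> P \<in> reach"
    using reach_components[of "Past a P"] by simp
  \<comment> \<open>A run from an initial process is replayed under the prefix, after
    \<open>a\<close> itself has been executed.\<close>
  show "P \<in> reach \<Longrightarrow> Past a P \<in> reach"
  proof (induction rule: reach_induct)
    case (initial P)
    then show ?case
      by (meson reach_initial reach_transition transition.intros(1) initial_simps(2))
  next
    case (transition P \<theta> P')
    then show ?case by (meson reach_transition transition.intros(2))
  qed
qed

lemma reach_Choice [simp]:
  "P \<oplus> Q \<in> reach \<longleftrightarrow> P \<in> reach \<and> initial Q \<or> initial P \<and> Q \<in> reach"
proof -
  have "P \<oplus> Q \<in> reach" if "P \<in> reach" "initial Q"
    using that
  proof (induction rule: reach_induct)
    case (transition P \<theta> P')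
    then show ?case by (meson reach_transition transition.intros(3))
  qed (simp add: reach_initial)
  moreover have "P \<oplus> Q \<in> reach" if "Q \<in> reach" "initial P"
    using that
  proof (induction rule: reach_induct)
    case (transition P \<theta> P')
    then show ?case by (meson reach_transition transition.intros(4))
  qed (simp add: reach_initial)
  ultimately show ?thesis using reach_components[of "P \<oplus> Q"] by auto
qed

lemma reach_ParD: "Par L P Q \<in> reach \<Longrightarrow> P \<in> reach \<and> Q \<in> reach"
  using reach_components[of "Par L P Q"] by simp

lemma tau_not_in_sync_set [simp]: "tau \<notin> sync_set L"
  using sync_set[of L] by simp

text \<open>The executed prefix of the normal form. It depends on initiality alone, so
  past-sensitive bisimilar processes receive the same mark.\<close>

definition exec_mark :: "'a::action proc \<Rightarrow> 'a option" where
  "exec_mark P = (if initial P then None else Some tau)"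

text \<open>Each mark arises from firing a prefix \<open>tau\<close>, which is never synchronised
  and so needs no partner in the other operand.\<close>

lemma reach_Par_opt_past:
  assumes "initial P" "initial Q"
    and "b\<^sub>1 = None \<or> b\<^sub>1 = Some tau" "b\<^sub>2 = None \<or> b\<^sub>2 = Some tau"
  shows "Par L (opt_past b\<^sub>1 P) (opt_past b\<^sub>2 Q) \<in> reach"
proof -
  have right: "Par L P' (Past tau Q) \<in> reach" if "Par L P' (Prefix tau Q) \<in> reach" for P'
    by (rule reach_transition[OF that transition.intros(6)[where a = tau]])
      (auto intro: transition.intros assms)
  \<comment> \<open>\<open>left\<close> starts from an initial composition, whereas
    \<open>right\<close> extends any reachable one; both operands get marked by letting the left one
    move first.\<close>
  have left: "Par L (Past tau P) Q' \<in> reach" if "initial Q'" for Q'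
  proof (rule reach_transition[OF _ transition.intros(5)[where a = tau]])
    show "Par L (Prefix tau P) Q' \<in> reach" using assms that by (simp add: reach_initial)
  qed (auto intro: transition.intros assms)
  have "Par L P (Past tau Q) \<in> reach"
    using assms by (intro right) (simp add: reach_initial)
  moreover have "Par L (Past tau P) (Past tau Q) \<in> reach"
    using assms by (intro right left) simp
  ultimately show ?thesis
    using assms left[of Q] by (auto simp: reach_initial)
qed

section \<open>Forward bisimilarity\<close>

text \<open>Bisimulations use proof terms only through their action, which is defined for every
  transition by \<open>transition_act\<close>. The equations for \<open>step\<close> below recurse
  on the term and serve as rewrite rules.\<close>

definition step :: "'a::action proc \<Rightarrow> 'a \<Rightarrow> 'a proc \<Rightarrow> bool" where
  "step P a P' \<longleftrightarrow> (\<exists>\<theta>. P \<midarrow>\<theta>\<rightarrow> P' \<and> act \<theta> = Some a)"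

inductive_cases transition_NullE: "Null \<midarrow>\<theta>\<rightarrow> R"
inductive_cases transition_PrefixE: "Prefix a P \<midarrow>\<theta>\<rightarrow> R"
inductive_cases transition_PastE: "Past a P \<midarrow>\<theta>\<rightarrow> R"
inductive_cases transition_ChoiceE: "(P \<oplus> Q) \<midarrow>\<theta>\<rightarrow> R"
inductive_cases transition_ParE: "Par L P Q \<midarrow>\<theta>\<rightarrow> R"

lemma step_Null [simp]: "\<not> step Null a R"
  by (auto simp: step_def elim: transition_NullE)

lemma step_Prefix [simp]: "step (Prefix a P) c R \<longleftrightarrow> c = a \<and> initial P \<and> R = Past a P"
proof
  assume "c = a \<and> initial P \<and> R = Past a P"
  then show "step (Prefix a P) c R"
    unfolding step_def by (intro exI[of _ "Act a"]) (auto intro: transition.intros)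
qed (auto simp: step_def elim!: transition_PrefixE)

lemma step_Past [simp]: "step (Past a P) c R \<longleftrightarrow> (\<exists>P'. R = Past a P' \<and> step P c P')"
  unfolding step_def
  by (auto elim!: transition_PastE) (metis act.simps(2) transition.intros(2))

lemma step_Choice [simp]:
  "step (P \<oplus> Q) c R \<longleftrightarrow> (\<exists>P'. R = P' \<oplus> Q \<and> step P c P' \<and> initial Q)
     \<or> (\<exists>Q'. R = P \<oplus> Q' \<and> step Q c Q' \<and> initial P)" (is "?l \<longleftrightarrow> ?r")
proof
  show "?l \<Longrightarrow> ?r" unfolding step_def by (auto elim!: transition_ChoiceE)
  show "?r \<Longrightarrow> ?l" unfolding step_def
    by (metis act.simps(3,4) transition.intros(3,4))
qed

lemma step_Par [simp]:
  "step (Par L P Q) c R \<longleftrightarrow>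
     (\<exists>P'. R = Par L P' Q \<and> step P c P' \<and> c \<notin> sync_set L)
     \<or> (\<exists>Q'. R = Par L P Q' \<and> step Q c Q' \<and> c \<notin> sync_set L)
     \<or> (\<exists>P' Q'. R = Par L P' Q' \<and> step P c P' \<and> step Q c Q' \<and> c \<in> sync_set L)"
  (is "?l \<longleftrightarrow> ?r")
proof
  show "?l \<Longrightarrow> ?r" unfolding step_def by (elim exE conjE transition_ParE) force+
next
  have "step (Par L P Q) c (Par L P' Q)" if "step P c P'" "c \<notin> sync_set L" for P'
    using that transition.intros(5)[of P _ P' c L Q] act.simps(5) unfolding step_def by metis
  moreover have "step (Par L P Q) c (Par L P Q')" if "step Q c Q'" "c \<notin> sync_set L" for Q'
    using that transition.intros(6)[of Q _ Q' c L P] act.simps(6) unfolding step_def by metis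
  moreover have "step (Par L P Q) c (Par L P' Q')"
    if PQ: "step P c P'" "step Q c Q'" and "c \<in> sync_set L" for P' Q'
  proof -
    obtain \<theta>\<^sub>1 \<theta>\<^sub>2 where "P \<midarrow>\<theta>\<^sub>1\<rightarrow> P'" "Q \<midarrow>\<theta>\<^sub>2\<rightarrow> Q'" "act \<theta>\<^sub>1 = Some c" "act \<theta>\<^sub>2 = Some c"
      using PQ unfolding step_def by blast
    then show ?thesis
      using that(3) unfolding step_def
      by (intro exI[of _ "Both \<theta>\<^sub>1 \<theta>\<^sub>2"]) (auto intro: transition.intros)
  qed
  ultimately show "?r \<Longrightarrow> ?l" by blast
qed

lemma step_not_initial: "step P a P' \<Longrightarrow> \<not> initial P'"
  by (auto simp: step_def dest: transition_not_initial)

text \<open>Initiality is not compared, which is what makes executed prefixes and discarded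
  alternatives invisible. Demanding transfer in both directions builds symmetry into the greatest
  fixed point.\<close>

coinductive fb :: "'a::action proc \<Rightarrow> 'a proc \<Rightarrow> bool" where
  fbI: "(\<And>a P'. step P a P' \<Longrightarrow> \<exists>Q'. step Q a Q' \<and> fb P' Q') \<Longrightarrow>
    (\<And>a Q'. step Q a Q' \<Longrightarrow> \<exists>P'. step P a P' \<and> fb P' Q') \<Longrightarrow> fb P Q"

lemma fb_stepD:
  assumes "fb P Q"
  shows "step P a P' \<Longrightarrow> \<exists>Q'. step Q a Q' \<and> fb P' Q'"
    and "step Q a Q' \<Longrightarrow> \<exists>P'. step P a P' \<and> fb P' Q'"
  using assms by (auto elim: fb.cases)

lemma fb_refl [simp]: "fb P P"
proof -
  have "P = Q \<Longrightarrow> fb P Q" for P Q :: "'a proc"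
    by (coinduction arbitrary: P Q) auto
  then show ?thesis by simp
qed

lemma fb_sym: "fb P Q \<Longrightarrow> fb Q P"
proof (coinduction arbitrary: P Q)
  case fb
  then show ?case using fb_stepD[OF fb] by fast
qed

lemma fb_trans [trans]:
  assumes "fb P Q" "fb Q R" shows "fb P R"
proof -
  have "\<exists>Q. fb P Q \<and> fb Q R" using assms by blast
  then show ?thesis
  proof (coinduction arbitrary: P R)
    case fb
    then obtain Q where Q: "fb P Q" "fb Q R" by blast
    show ?case using fb_stepD[OF Q(1)] fb_stepD[OF Q(2)] by (simp; meson)
  qed
qed

lemma fb_cong: "fb P Q \<Longrightarrow> fb P R \<longleftrightarrow> fb Q R"
  using fb_sym fb_trans by blast

lemma fb_Past: "fb (Past a P) P"
  by (coinduction arbitrary: P) auto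

lemma fb_opt_past: "fb (opt_past b P) P"
  by (cases b) (auto intro: fb_Past)

text \<open>The side \<open>Q\<close> can only move while \<open>P\<close> is initial, hence never.
  Derivatives of \<open>P\<close> are again not initial, so the hypotheses survive along the
  coinduction.\<close>

lemma fb_Choice_left: "\<not> initial P \<Longrightarrow> initial Q \<Longrightarrow> fb (P \<oplus> Q) P"
  by (coinduction arbitrary: P) (auto dest: step_not_initial)

lemma fb_Choice_right: "initial P \<Longrightarrow> \<not> initial Q \<Longrightarrow> fb (P \<oplus> Q) Q"
  by (coinduction arbitrary: Q) (auto dest: step_not_initial)

lemma step_Par_simulated:
  assumes "fb P\<^sub>1 Q\<^sub>1" "fb P\<^sub>2 Q\<^sub>2" "step (Par L P\<^sub>1 P\<^sub>2) a R"
  obtains P\<^sub>1' P\<^sub>2' Q\<^sub>1' Q\<^sub>2' where "R = Par L P\<^sub>1' P\<^sub>2'" "step (Par L Q\<^sub>1 Q\<^sub>2) a (Par L Q\<^sub>1' Q\<^sub>2')"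
    "fb P\<^sub>1' Q\<^sub>1'" "fb P\<^sub>2' Q\<^sub>2'"
proof -
  from assms(3) consider
      P\<^sub>1' where "R = Par L P\<^sub>1' P\<^sub>2" "step P\<^sub>1 a P\<^sub>1'" "a \<notin> sync_set L"
    | P\<^sub>2' where "R = Par L P\<^sub>1 P\<^sub>2'" "step P\<^sub>2 a P\<^sub>2'" "a \<notin> sync_set L"
    | P\<^sub>1' P\<^sub>2' where "R = Par L P\<^sub>1' P\<^sub>2'" "step P\<^sub>1 a P\<^sub>1'" "step P\<^sub>2 a P\<^sub>2'" "a \<in> sync_set L"
    unfolding step_Par by blast
  then show thesis
  proof cases
    case 1
    then show thesis using fb_stepD(1)[OF assms(1)] assms(2) that unfolding step_Par by metis
  next
    case 2
    then show thesis using fb_stepD(1)[OF assms(2)] assms(1) that unfolding step_Par by metis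
  next
    case 3
    obtain Q\<^sub>1' where "step Q\<^sub>1 a Q\<^sub>1'" "fb P\<^sub>1' Q\<^sub>1'" using fb_stepD(1)[OF assms(1) 3(2)] by blast
    moreover obtain Q\<^sub>2' where "step Q\<^sub>2 a Q\<^sub>2'" "fb P\<^sub>2' Q\<^sub>2'"
      using fb_stepD(1)[OF assms(2) 3(3)] by blast
    ultimately show thesis using 3 that unfolding step_Par by blast
  qed
qed

text \<open>No assumption on initiality is made, because the transition rules for \<open>Par\<close>
  do not test it.\<close>

lemma fb_Par:
  assumes "fb P\<^sub>1 Q\<^sub>1" "fb P\<^sub>2 Q\<^sub>2"
  shows "fb (Par L P\<^sub>1 P\<^sub>2) (Par L Q\<^sub>1 Q\<^sub>2)"
proof -
  \<comment> \<open>The candidate relation is symmetric, so the single transfer direction of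
    \<open>step_Par_simulated\<close> covers both.\<close>
  define X where "X P Q \<longleftrightarrow>
    (\<exists>P\<^sub>1 P\<^sub>2 Q\<^sub>1 Q\<^sub>2. P = Par L P\<^sub>1 P\<^sub>2 \<and> Q = Par L Q\<^sub>1 Q\<^sub>2 \<and> fb P\<^sub>1 Q\<^sub>1 \<and> fb P\<^sub>2 Q\<^sub>2)" for P Q
  have X_sym: "X Q P" if "X P Q" for P Q
    using that fb_sym unfolding X_def by metis
  have X_step: "\<exists>Q'. step Q a Q' \<and> X P' Q'" if X: "X P Q" and s: "step P a P'" for P Q P' a
  proof -
    obtain P\<^sub>1 P\<^sub>2 Q\<^sub>1 Q\<^sub>2 where PQ: "P = Par L P\<^sub>1 P\<^sub>2" "Q = Par L Q\<^sub>1 Q\<^sub>2" "fb P\<^sub>1 Q\<^sub>1" "fb P\<^sub>2 Q\<^sub>2"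
      using X unfolding X_def by blast
    show ?thesis
      using step_Par_simulated[OF PQ(3,4) s[unfolded PQ(1)]] unfolding X_def PQ(2) by metis
  qed
  have "X (Par L P\<^sub>1 P\<^sub>2) (Par L Q\<^sub>1 Q\<^sub>2)" using assms unfolding X_def by blast
  then show ?thesis
  proof (rule fb.coinduct)
    fix P Q assume X: "X P Q"
    have "\<exists>P''. step P a P'' \<and> X P'' R" if "step Q a R" for a R
      using X_step[OF X_sym[OF X] that] X_sym by metis
    then show "\<exists>P' Q'. P = P' \<and> Q = Q' \<and>
        (\<forall>a R. step P' a R \<longrightarrow> (\<exists>Q''. step Q' a Q'' \<and> (X R Q'' \<or> fb R Q''))) \<and>
        (\<forall>a R. step Q' a R \<longrightarrow> (\<exists>P''. step P' a P'' \<and> (X P'' R \<or> fb P'' R)))"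
      using X_step[OF X] by (intro exI[of _ P] exI[of _ Q]) metis
  qed
qed

text \<open>Derivatives are taken up to \<^const>\<open>fb\<close>, which hides the executed prefixes and the discarded
  alternatives that transitions leave behind.\<close>

definition deriv :: "'a::action proc \<Rightarrow> 'a \<Rightarrow> 'a proc \<Rightarrow> bool" where
  "deriv P a R \<longleftrightarrow> (\<exists>P'. step P a P' \<and> fb P' R)"

text \<open>The same \<open>R\<close> occurs on both sides, so bisimilarity becomes equality of
  derivative sets, and checking an equation often reduces to propositional reasoning.\<close>

lemma fb_iff_deriv: "fb P Q \<longleftrightarrow> (\<forall>a R. deriv P a R \<longleftrightarrow> deriv Q a R)"
proof
  assume "fb P Q"
  then show "\<forall>a R. deriv P a R \<longleftrightarrow> deriv Q a R"
    unfolding deriv_def using fb_stepD[of P Q] fb_cong by metis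
next
  assume "\<forall>a R. deriv P a R \<longleftrightarrow> deriv Q a R"
  then show "fb P Q"
    unfolding deriv_def by (intro fbI) (metis fb_refl fb_sym)+
qed

lemma deriv_Null [simp]: "\<not> deriv Null a R"
  by (simp add: deriv_def)

lemma deriv_Prefix [simp]: "deriv (Prefix a P) c R \<longleftrightarrow> c = a \<and> initial P \<and> fb P R"
  unfolding deriv_def by (auto simp: fb_cong[OF fb_Past])

lemma deriv_Choice [simp]:
  "deriv (P \<oplus> Q) c R \<longleftrightarrow> deriv P c R \<and> initial Q \<or> deriv Q c R \<and> initial P"
proof -
  have "fb (P' \<oplus> Q) R \<longleftrightarrow> fb P' R" if "step P c P'" "initial Q" for P'
    using that by (intro fb_cong fb_Choice_left) (auto dest: step_not_initial)
  moreover have "fb (P \<oplus> Q') R \<longleftrightarrow> fb Q' R" if "step Q c Q'" "initial P" for Q'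
    using that by (intro fb_cong fb_Choice_right) (auto dest: step_not_initial)
  ultimately show ?thesis unfolding deriv_def by auto
qed

text \<open>Steps of the operands may be weakened to derivatives because \<open>fb\<close> is a
  congruence for \<open>Par\<close>.\<close>

lemma deriv_Par:
  "deriv (Par L P Q) c R \<longleftrightarrow>
     (\<exists>P'. fb (Par L P' Q) R \<and> deriv P c P' \<and> c \<notin> sync_set L)
     \<or> (\<exists>Q'. fb (Par L P Q') R \<and> deriv Q c Q' \<and> c \<notin> sync_set L)
     \<or> (\<exists>P' Q'. fb (Par L P' Q') R \<and> deriv P c P' \<and> deriv Q c Q' \<and> c \<in> sync_set L)"
  (is "?l \<longleftrightarrow> ?r")
proof
  assume ?l
  then obtain R' where R': "step (Par L P Q) c R'" "fb R' R" unfolding deriv_def by blast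
  have "step X c Y \<Longrightarrow> deriv X c Y" for X Y :: "'a proc" by (auto simp: deriv_def)
  then show ?r using R' unfolding step_Par by blast
next
  have L: "fb (Par L X' Y) R" if "fb X' X" "fb (Par L X Y) R" for X X' Y
    using that fb_Par fb_refl fb_trans by blast
  have R: "fb (Par L X Y') R" if "fb Y' Y" "fb (Par L X Y) R" for X Y Y'
    using that fb_Par fb_refl fb_trans by blast
  assume ?r
  then show ?l unfolding deriv_def step_Par using L R by (elim disjE exE conjE) blast+
qed

lemma fb_Prefix: "fb P Q \<Longrightarrow> initial P \<Longrightarrow> initial Q \<Longrightarrow> fb (Prefix a P) (Prefix a Q)"
  using fb_cong[of P Q] by (simp add: fb_iff_deriv[of "Prefix a P"])

text \<open>Here agreement on initiality is essential: \<open>Past a Null\<close> and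
  \<open>Null\<close> are related by \<open>fb\<close>, but composed with
  \<open>Prefix b Null\<close> only the latter allows \<open>b\<close>.\<close>

lemma fb_Choice:
  assumes "fb P\<^sub>1 Q\<^sub>1" "fb P\<^sub>2 Q\<^sub>2" "initial P\<^sub>1 \<longleftrightarrow> initial Q\<^sub>1" "initial P\<^sub>2 \<longleftrightarrow> initial Q\<^sub>2"
  shows "fb (P\<^sub>1 \<oplus> P\<^sub>2) (Q\<^sub>1 \<oplus> Q\<^sub>2)"
  using assms by (auto simp: fb_iff_deriv)

lemma FB_ps_iff:
  "(P, Q) \<in> FB_ps \<longleftrightarrow> P \<in> reach \<and> Q \<in> reach \<and> (initial P \<longleftrightarrow> initial Q) \<and> fb P Q"
proof
  assume "(P, Q) \<in> FB_ps"
  then obtain B where B: "ps_forward_bisim B" "(P, Q) \<in> B" by (auto simp: FB_ps_def)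
  have symB: "(Y, X) \<in> B" if "(X, Y) \<in> B" for X Y
    using B(1) that unfolding ps_forward_bisim_def by (meson symD)
  have stepB: "\<exists>Y'. step Y a Y' \<and> (X', Y') \<in> B" if XY: "(X, Y) \<in> B" and s: "step X a X'" for X Y a X'
  proof -
    obtain \<theta> where \<theta>: "X \<midarrow>\<theta>\<rightarrow> X'" "act \<theta> = Some a" using s by (auto simp: step_def)
    then obtain \<theta>\<^sub>2 Y' where "Y \<midarrow>\<theta>\<^sub>2\<rightarrow> Y'" "act \<theta> = act \<theta>\<^sub>2" "(X', Y') \<in> B"
      using B(1) XY unfolding ps_forward_bisim_def by blast
    then show ?thesis using \<theta>(2) unfolding step_def by metis
  qed
  have "fb P Q"
    using B(2)
  proof (coinduction arbitrary: P Q)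
    case fb
    then show ?case using stepB symB by meson
  qed
  then show "P \<in> reach \<and> Q \<in> reach \<and> (initial P \<longleftrightarrow> initial Q) \<and> fb P Q"
    using B unfolding ps_forward_bisim_def by auto
next
  \<comment> \<open>The right-hand side is itself a past-sensitive bisimulation: matching targets
    are both reachable and both not initial, so every condition holds again after a step.\<close>
  define B :: "('a proc \<times> 'a proc) set" where
    "B = {(P, Q). P \<in> reach \<and> Q \<in> reach \<and> (initial P \<longleftrightarrow> initial Q) \<and> fb P Q}"
  have "\<exists>\<theta>\<^sub>2 Y'. Y \<midarrow>\<theta>\<^sub>2\<rightarrow> Y' \<and> act \<theta>\<^sub>1 = act \<theta>\<^sub>2 \<and> (X', Y') \<in> B"
    if XY: "(X, Y) \<in> B" and t: "X \<midarrow>\<theta>\<^sub>1\<rightarrow> X'" for X Y X' \<theta>\<^sub>1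
  proof -
    obtain a where a: "act \<theta>\<^sub>1 = Some a" using transition_act[OF t] by blast
    then have "step X a X'" using t by (auto simp: step_def)
    then obtain Y' where Y': "step Y a Y'" "fb X' Y'"
      using XY fb_stepD(1) unfolding B_def by blast
    then obtain \<theta>\<^sub>2 where "Y \<midarrow>\<theta>\<^sub>2\<rightarrow> Y'" "act \<theta>\<^sub>2 = Some a" by (auto simp: step_def)
    then show ?thesis
      using XY Y' t a unfolding B_def
      by (intro exI[of _ \<theta>\<^sub>2] exI[of _ Y'])
        (auto intro: reach_transition dest: transition_not_initial)
  qed
  then have "ps_forward_bisim B"
    unfolding ps_forward_bisim_def by (auto simp: B_def sym_def fb_sym)
  moreover assume "P \<in> reach \<and> Q \<in> reach \<and> (initial P \<longleftrightarrow> initial Q) \<and> fb P Q"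
  then have "(P, Q) \<in> B" by (simp add: B_def)
  ultimately show "(P, Q) \<in> FB_ps" by (auto simp: FB_ps_def)
qed

section \<open>Soundness\<close>

lemma altcomp_initial_iff: "altcomp I f S \<Longrightarrow> initial S \<longleftrightarrow> (\<forall>i\<in>I. initial (f i))"
  by (induction rule: altcomp.induct) auto

text \<open>A summand moves only while the others are initial; under the hypothesis none is
  blocked.\<close>

lemma altcomp_deriv:
  "altcomp I f S \<Longrightarrow> (\<And>i. i \<in> I \<Longrightarrow> initial (f i)) \<Longrightarrow>
    deriv S c R \<longleftrightarrow> (\<exists>i\<in>I. deriv (f i) c R)"
proof (induction rule: altcomp.induct)
  case (3 I f S J T)
  then show ?case using altcomp_initial_iff[of I f S] altcomp_initial_iff[of J f T] by auto
qed auto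

lemma altcomp_finite: "altcomp I f S \<Longrightarrow> finite I"
  by (induction rule: altcomp.induct) auto

lemma altcomp_Prefix_not_Past: "altcomp I (\<lambda>i. Prefix (a i) (P i)) S \<Longrightarrow> S \<noteq> Past b Q"
  by (erule altcomp.cases) auto

text \<open>The premises of \<open>F8\<close> do not mention initiality; it is recovered here from
  the normal form, once a leading executed prefix is excluded.\<close>

lemma F_nf_sum_initial:
  assumes "F_nf S" "altcomp I (\<lambda>i. Prefix (a i) (P i)) S"
  shows "initial S"
  using assms(1)
proof cases
  case (1 I' a' P' S' b)
  then have "b = None" using assms(2) altcomp_Prefix_not_Past by (cases b) force+
  moreover have "initial S'" using 1 altcomp_initial_iff by fastforce
  ultimately show ?thesis using 1 by simp
qed

text \<open>The three sums account for moves of the left operand, of the right operand, and of both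
  together. Executed prefixes are left out, since \<open>fb\<close> does not see them.\<close>

lemma fb_expansion:
  assumes S\<^sub>1: "altcomp I\<^sub>1 (\<lambda>i. Prefix (a\<^sub>1 i) (P\<^sub>1 i)) S\<^sub>1" "initial S\<^sub>1"
    and S\<^sub>2: "altcomp I\<^sub>2 (\<lambda>i. Prefix (a\<^sub>2 i) (P\<^sub>2 i)) S\<^sub>2" "initial S\<^sub>2"
    and T\<^sub>1: "altcomp {i \<in> I\<^sub>1. a\<^sub>1 i \<notin> sync_set L} (\<lambda>i. Prefix (a\<^sub>1 i) (Par L (P\<^sub>1 i) S\<^sub>2)) T\<^sub>1"
    and T\<^sub>2: "altcomp {i \<in> I\<^sub>2. a\<^sub>2 i \<notin> sync_set L} (\<lambda>i. Prefix (a\<^sub>2 i) (Par L S\<^sub>1 (P\<^sub>2 i))) T\<^sub>2"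
    and T\<^sub>3: "altcomp {(i, j). i \<in> I\<^sub>1 \<and> a\<^sub>1 i \<in> sync_set L \<and> j \<in> I\<^sub>2 \<and> a\<^sub>2 j = a\<^sub>1 i}
         (\<lambda>(i, j). Prefix (a\<^sub>1 i) (Par L (P\<^sub>1 i) (P\<^sub>2 j))) T\<^sub>3"
  shows "initial (T\<^sub>1 \<oplus> T\<^sub>2 \<oplus> T\<^sub>3)" and "fb (Par L S\<^sub>1 S\<^sub>2) (T\<^sub>1 \<oplus> T\<^sub>2 \<oplus> T\<^sub>3)"
proof -
  have i\<^sub>1: "initial (P\<^sub>1 i)" if "i \<in> I\<^sub>1" for i
    using altcomp_initial_iff[OF S\<^sub>1(1)] S\<^sub>1(2) that by auto
  have i\<^sub>2: "initial (P\<^sub>2 i)" if "i \<in> I\<^sub>2" for i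
    using altcomp_initial_iff[OF S\<^sub>2(1)] S\<^sub>2(2) that by auto
  show iT: "initial (T\<^sub>1 \<oplus> T\<^sub>2 \<oplus> T\<^sub>3)"
    using altcomp_initial_iff[OF T\<^sub>1] altcomp_initial_iff[OF T\<^sub>2] altcomp_initial_iff[OF T\<^sub>3]
    by (auto simp: i\<^sub>1 i\<^sub>2 S\<^sub>1 S\<^sub>2)
  have d\<^sub>1: "deriv S\<^sub>1 c R \<longleftrightarrow> (\<exists>i\<in>I\<^sub>1. c = a\<^sub>1 i \<and> fb (P\<^sub>1 i) R)" for c R
    by (subst altcomp_deriv[OF S\<^sub>1(1)]) (auto simp: i\<^sub>1)
  have d\<^sub>2: "deriv S\<^sub>2 c R \<longleftrightarrow> (\<exists>i\<in>I\<^sub>2. c = a\<^sub>2 i \<and> fb (P\<^sub>2 i) R)" for c R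
    by (subst altcomp_deriv[OF S\<^sub>2(1)]) (auto simp: i\<^sub>2)
  have e\<^sub>1: "deriv T\<^sub>1 c R \<longleftrightarrow>
      (\<exists>i\<in>I\<^sub>1. a\<^sub>1 i \<notin> sync_set L \<and> c = a\<^sub>1 i \<and> fb (Par L (P\<^sub>1 i) S\<^sub>2) R)" for c R
    by (subst altcomp_deriv[OF T\<^sub>1]) (auto simp: i\<^sub>1 S\<^sub>2)
  have e\<^sub>2: "deriv T\<^sub>2 c R \<longleftrightarrow>
      (\<exists>i\<in>I\<^sub>2. a\<^sub>2 i \<notin> sync_set L \<and> c = a\<^sub>2 i \<and> fb (Par L S\<^sub>1 (P\<^sub>2 i)) R)" for c R
    by (subst altcomp_deriv[OF T\<^sub>2]) (auto simp: i\<^sub>2 S\<^sub>1)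
  have e\<^sub>3: "deriv T\<^sub>3 c R \<longleftrightarrow> (\<exists>i\<in>I\<^sub>1. \<exists>j\<in>I\<^sub>2.
      a\<^sub>1 i \<in> sync_set L \<and> a\<^sub>2 j = a\<^sub>1 i \<and> c = a\<^sub>1 i \<and> fb (Par L (P\<^sub>1 i) (P\<^sub>2 j)) R)" for c R
    by (subst altcomp_deriv[OF T\<^sub>3]) (simp_all add: i\<^sub>1 i\<^sub>2 split_beta, use i\<^sub>1 i\<^sub>2 in blast)
  \<comment> \<open>Replaces derivatives, known only up to \<open>fb\<close>, by the actual
    continuations of the summands.\<close>
  have fb_ParI: "fb (Par L P P') R" if "fb P Q" "fb P' Q'" "fb (Par L Q Q') R" for P P' Q Q' R
    using fb_trans[OF fb_Par[OF that(1,2)] that(3)] .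
  have "deriv (Par L S\<^sub>1 S\<^sub>2) c R \<longleftrightarrow> deriv (T\<^sub>1 \<oplus> T\<^sub>2 \<oplus> T\<^sub>3) c R" (is "?l \<longleftrightarrow> ?r") for c R
  proof
    assume ?l
    then consider P' where "fb (Par L P' S\<^sub>2) R" "deriv S\<^sub>1 c P'" "c \<notin> sync_set L"
      | Q' where "fb (Par L S\<^sub>1 Q') R" "deriv S\<^sub>2 c Q'" "c \<notin> sync_set L"
      | P' Q' where "fb (Par L P' Q') R" "deriv S\<^sub>1 c P'" "deriv S\<^sub>2 c Q'" "c \<in> sync_set L"
      unfolding deriv_Par by blast
    then have "deriv T\<^sub>1 c R \<or> deriv T\<^sub>2 c R \<or> deriv T\<^sub>3 c R"
    proof cases
      case 1
      then obtain i where "i \<in> I\<^sub>1" "c = a\<^sub>1 i" "fb (P\<^sub>1 i) P'" by (auto simp: d\<^sub>1)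
      then show ?thesis using 1 fb_ParI[OF _ fb_refl] by (auto simp: e\<^sub>1)
    next
      case 2
      then obtain j where "j \<in> I\<^sub>2" "c = a\<^sub>2 j" "fb (P\<^sub>2 j) Q'" by (auto simp: d\<^sub>2)
      then show ?thesis using 2 fb_ParI[OF fb_refl] by (auto simp: e\<^sub>2)
    next
      case 3
      then obtain i where i: "i \<in> I\<^sub>1" "c = a\<^sub>1 i" "fb (P\<^sub>1 i) P'" by (auto simp: d\<^sub>1)
      obtain j where j: "j \<in> I\<^sub>2" "c = a\<^sub>2 j" "fb (P\<^sub>2 j) Q'" using 3 by (auto simp: d\<^sub>2)
      have "fb (Par L (P\<^sub>1 i) (P\<^sub>2 j)) R" using fb_ParI[OF i(3) j(3) 3(1)] .
      then have "deriv T\<^sub>3 c R"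
        unfolding e\<^sub>3 using i(1,2) j(1,2) 3(4) by (intro bexI[of _ i] bexI[of _ j]) auto
      then show ?thesis by blast
    qed
    then show ?r using iT by auto
  next
    assume ?r
    then have "deriv T\<^sub>1 c R \<or> deriv T\<^sub>2 c R \<or> deriv T\<^sub>3 c R" by auto
    moreover have "deriv S\<^sub>1 (a\<^sub>1 i) (P\<^sub>1 i)" if "i \<in> I\<^sub>1" for i using that by (auto simp: d\<^sub>1)
    moreover have "deriv S\<^sub>2 (a\<^sub>2 j) (P\<^sub>2 j)" if "j \<in> I\<^sub>2" for j using that by (auto simp: d\<^sub>2)
    ultimately show ?l unfolding deriv_Par e\<^sub>1 e\<^sub>2 e\<^sub>3 by (elim disjE bexE conjE) metis+
  qed
  then show "fb (Par L S\<^sub>1 S\<^sub>2) (T\<^sub>1 \<oplus> T\<^sub>2 \<oplus> T\<^sub>3)" unfolding fb_iff_deriv by blast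
qed

lemma axiom_F_sound: "axiom_F P Q \<Longrightarrow> (initial P \<longleftrightarrow> initial Q) \<and> fb P Q"
proof (induction rule: axiom_F.induct)
  case (F1 P Q R)
  then show ?case by (auto simp: fb_iff_deriv)
next
  case (F2 P Q)
  then show ?case by (auto simp: fb_iff_deriv)
next
  case (F3 P)
  then show ?case by (auto simp: fb_iff_deriv)
next
  case (F4 P)
  then show ?case by (auto simp: fb_iff_deriv)
next
  case (F5 P a b)
  then show ?case by (simp add: fb_cong[OF fb_Past] fb_sym[OF fb_Past])
next
  case (F6 P a)
  then show ?case by (auto intro: fb_Past)
next
  case (F7 P Q)
  then show ?case by (auto intro: fb_Choice_left)
next
  case (F8 I\<^sub>1 a\<^sub>1 P\<^sub>1 S\<^sub>1 I\<^sub>2 a\<^sub>2 P\<^sub>2 S\<^sub>2 L T\<^sub>1 T\<^sub>2 T\<^sub>3 b b\<^sub>1 b\<^sub>2)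
  have i: "initial S\<^sub>1" "initial S\<^sub>2" using F_nf_sum_initial[OF F8(2,1)] F_nf_sum_initial[OF F8(4,3)] .
  note e = fb_expansion[OF F8(1) i(1) F8(3) i(2) F8(5-7)]
  \<comment> \<open>The marks are dropped inside both operands, the bare sums are expanded, and the
    mark of the right-hand side is put back. Agreement on initiality then rests on the condition
    \<open>F8(8)\<close> on the marks.\<close>
  have "fb (Par L (opt_past b\<^sub>1 S\<^sub>1) (opt_past b\<^sub>2 S\<^sub>2)) (Par L S\<^sub>1 S\<^sub>2)"
    by (intro fb_Par fb_opt_past)
  also note e(2)
  also have "fb (T\<^sub>1 \<oplus> T\<^sub>2 \<oplus> T\<^sub>3) (opt_past b (T\<^sub>1 \<oplus> T\<^sub>2 \<oplus> T\<^sub>3))"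
    by (rule fb_sym[OF fb_opt_past])
  finally show ?case using i e(1) F8(8) by (auto simp del: initial_simps(4))
qed

text \<open>Agreement on initiality is carried through the induction along with \<open>fb\<close>,
  because closure under choice depends on it.\<close>

lemma derivable_F_sound: "derivable_F P Q \<Longrightarrow> (P, Q) \<in> FB_ps"
  unfolding FB_ps_iff
proof (induction rule: derivable_F.induct)
  case (ax P Q)
  then show ?case using axiom_F_sound by blast
next
  case (refl P)
  then show ?case by simp
next
  case (sym P Q)
  then show ?case by (auto intro: fb_sym)
next
  case (trans P Q R)
  then show ?case using fb_trans[of P Q R] by simp
next
  case (prefix P Q a)
  then show ?case by (auto intro: fb_Prefix reach_initial)
next
  case (past P Q a)
  then show ?case by (simp add: fb_cong[OF fb_Past] fb_trans[OF _ fb_sym[OF fb_Past]])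
next
  case (choice P\<^sub>1 Q\<^sub>1 P\<^sub>2 Q\<^sub>2)
  then show ?case by (simp add: fb_Choice)
next
  case (par P\<^sub>1 Q\<^sub>1 P\<^sub>2 Q\<^sub>2 L)
  then show ?case by (simp add: fb_Par)
qed

lemma derivable_F_initial: "derivable_F P Q \<Longrightarrow> initial P \<longleftrightarrow> initial Q"
  and derivable_F_fb: "derivable_F P Q \<Longrightarrow> fb P Q"
  and derivable_F_reach: "derivable_F P Q \<Longrightarrow> P \<in> reach" "derivable_F P Q \<Longrightarrow> Q \<in> reach"
  using derivable_F_sound FB_ps_iff by blast+

section \<open>Normal forms\<close>

declare derivable_F.trans [trans]

text \<open>A structural version of initial forward normal forms, free of index sets.
  \<open>Null\<close> is barred as an operand because an alternative composition of prefixes is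
  \<open>Null\<close> only for the empty index set.\<close>

inductive sum_nf :: "'a::action proc \<Rightarrow> bool" where
  "sum_nf Null"
| "sum_nf P \<Longrightarrow> sum_nf (Prefix a P)"
| "sum_nf P \<Longrightarrow> sum_nf Q \<Longrightarrow> P \<noteq> Null \<Longrightarrow> Q \<noteq> Null \<Longrightarrow> sum_nf (P \<oplus> Q)"

lemma sum_nf_initial: "sum_nf P \<Longrightarrow> initial P"
  by (induction rule: sum_nf.induct) auto

section \<open>From sum normal forms to indexed alternative compositions\<close>

lemma altcomp_cong: "altcomp I f S \<Longrightarrow> (\<And>i. i \<in> I \<Longrightarrow> f i = g i) \<Longrightarrow> altcomp I g S"
proof (induction rule: altcomp.induct)
  case (2 i f)
  then show ?case using altcomp.intros(2)[of i g] by simp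
qed (auto intro: altcomp.intros)

lemma altcomp_exists: "finite I \<Longrightarrow> \<exists>S. altcomp I f S"
proof (induction rule: finite_induct)
  case (insert x F)
  show ?case
  proof (cases "F = {}")
    case False
    then show ?thesis
      using insert altcomp.intros(3)[OF altcomp.intros(2)[of x f]] by force
  qed (auto intro: altcomp.intros)
qed (auto intro: altcomp.intros)

text \<open>The left end \<open>n\<close> is arbitrary so that the operands of a choice can occupy
  adjacent, hence disjoint, intervals. The size bound later drives the induction for the expansion
  law.\<close>

lemma sum_nf_altcomp_interval:
  "sum_nf S \<Longrightarrow> S \<noteq> Null \<Longrightarrow> \<exists>m a P. n < m \<and> altcomp {n..<m} (\<lambda>i::nat. Prefix (a i) (P i)) S \<and>
     (\<forall>i. sum_nf (P i) \<and> size (P i) < size S)"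
proof (induction arbitrary: n rule: sum_nf.induct)
  case (2 P a)
  have "altcomp {n..<Suc n} (\<lambda>i::nat. Prefix a P) (Prefix a P)"
    using altcomp.intros(2)[of n "\<lambda>i. Prefix a P"] by simp
  then show ?case using 2(1)
    by (intro exI[of _ "Suc n"] exI[of _ "\<lambda>i. a"] exI[of _ "\<lambda>i. P"]) auto
next
  case (3 P Q)
  obtain m a R where P: "n < m" "altcomp {n..<m} (\<lambda>i::nat. Prefix (a i) (R i)) P"
     "\<forall>i. sum_nf (R i) \<and> size (R i) < size P"
    using 3(5)[OF 3(3)] by blast
  obtain k a' R' where Q: "m < k" "altcomp {m..<k} (\<lambda>i::nat. Prefix (a' i) (R' i)) Q"
     "\<forall>i. sum_nf (R' i) \<and> size (R' i) < size Q"
    using 3(6)[OF 3(4)] by blast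
  \<comment> \<open>The two families are glued at the common end \<open>m\<close> of the
    intervals.\<close>
  let ?a = "\<lambda>i. if i < m then a i else a' i"
  let ?R = "\<lambda>i. if i < m then R i else R' i"
  have "altcomp {n..<m} (\<lambda>i. Prefix (?a i) (?R i)) P"
    by (rule altcomp_cong[OF P(2)]) auto
  moreover have "altcomp {m..<k} (\<lambda>i. Prefix (?a i) (?R i)) Q"
    by (rule altcomp_cong[OF Q(2)]) auto
  ultimately have "altcomp ({n..<m} \<union> {m..<k}) (\<lambda>i. Prefix (?a i) (?R i)) (P \<oplus> Q)"
    by (rule altcomp.intros) (use P Q in auto)
  moreover have "{n..<m} \<union> {m..<k} = {n..<k}" using P Q by auto
  moreover have "n < k" using P Q by simp
  moreover have "\<forall>i. sum_nf (?R i) \<and> size (?R i) < size (P \<oplus> Q)"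
    using P(3) Q(3) by (auto simp: less_Suc_eq trans_less_add1 trans_less_add2)
  ultimately show ?case
    by (intro exI[of _ k] exI[of _ ?a] exI[of _ ?R]) simp
qed simp

lemma sum_nf_altcomp:
  assumes "sum_nf S"
  shows "\<exists>I a P. altcomp I (\<lambda>i::nat. Prefix (a i) (P i)) S \<and>
    (\<forall>i\<in>I. sum_nf (P i) \<and> size (P i) < size S)"
proof (cases "S = Null")
  case True
  then show ?thesis using altcomp.intros(1) by blast
next
  case False
  then show ?thesis using sum_nf_altcomp_interval[OF assms, of 0] by blast
qed

lemma sum_nf_F_nf: "sum_nf S \<Longrightarrow> F_nf S"
proof (induction S rule: measure_induct_rule[of size])
  case (less S)
  obtain I a P where S: "altcomp I (\<lambda>i::nat. Prefix (a i) (P i)) S"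
    "\<And>i. i \<in> I \<Longrightarrow> sum_nf (P i)" "\<And>i. i \<in> I \<Longrightarrow> size (P i) < size S"
    using sum_nf_altcomp[OF less(2)] by blast
  have "F_nf (opt_past None S)"
    by (rule F_nf.intros[OF S(1)]) (use S less in \<open>auto intro: sum_nf_initial\<close>)
  then show ?case by simp
qed

section \<open>Equational laws with reachability premises discharged\<close>

lemma derivable_F_Prefix:
  assumes "derivable_F P Q" "initial P"
  shows "derivable_F (Prefix a P) (Prefix a Q)"
  using derivable_F.prefix[OF assms(1)] derivable_F_initial[OF assms(1)] assms(2) by simp

lemma derivable_F_Choice:
  assumes "derivable_F P\<^sub>1 Q\<^sub>1" "derivable_F P\<^sub>2 Q\<^sub>2" "initial P\<^sub>1" "initial P\<^sub>2"
  shows "derivable_F (P\<^sub>1 \<oplus> P\<^sub>2) (Q\<^sub>1 \<oplus> Q\<^sub>2)"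
  using derivable_F.choice[OF assms(1,2)] derivable_F_initial[OF assms(1)]
    derivable_F_initial[OF assms(2)] assms(3,4) by (simp add: reach_initial)

lemma derivable_F_opt_past:
  assumes "derivable_F P Q"
  shows "derivable_F (opt_past b P) (opt_past b Q)"
  using derivable_F.past[OF assms] derivable_F_reach[OF assms] assms by (cases b) simp_all

lemma derivable_F_comm: "initial P \<Longrightarrow> initial Q \<Longrightarrow> derivable_F (P \<oplus> Q) (Q \<oplus> P)"
  by (auto intro!: derivable_F.ax axiom_F.F2 reach_initial)

lemma derivable_F_assoc:
  "initial P \<Longrightarrow> initial Q \<Longrightarrow> initial R \<Longrightarrow> derivable_F ((P \<oplus> Q) \<oplus> R) (P \<oplus> (Q \<oplus> R))"
  by (auto intro!: derivable_F.ax axiom_F.F1 reach_initial)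

lemma derivable_F_idem: "initial P \<Longrightarrow> derivable_F (P \<oplus> P) P"
  by (auto intro!: derivable_F.ax axiom_F.F4 reach_initial)

lemma derivable_F_Null: "initial P \<Longrightarrow> derivable_F (P \<oplus> Null) P"
  by (auto intro!: derivable_F.ax axiom_F.F3 reach_initial)

definition has_sum_nf :: "'a::action proc \<Rightarrow> bool" where
  "has_sum_nf P \<longleftrightarrow> (\<exists>N. sum_nf N \<and> derivable_F P N)"

lemma has_sum_nf_initial: "has_sum_nf P \<Longrightarrow> initial P"
  unfolding has_sum_nf_def using derivable_F_initial[of P] sum_nf_initial by blast

lemma has_sum_nf_trans: "derivable_F P Q \<Longrightarrow> has_sum_nf Q \<Longrightarrow> has_sum_nf P"
  unfolding has_sum_nf_def using derivable_F.trans[of P Q] by blast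

lemma sum_nf_has_sum_nf: "sum_nf P \<Longrightarrow> has_sum_nf P"
  using derivable_F.refl[OF reach_initial[OF sum_nf_initial[of P]]]
  unfolding has_sum_nf_def by blast

lemma has_sum_nf_Null: "has_sum_nf Null"
  by (intro sum_nf_has_sum_nf sum_nf.intros)

lemma has_sum_nf_Prefix: "has_sum_nf P \<Longrightarrow> has_sum_nf (Prefix a P)"
  using has_sum_nf_initial[of P] derivable_F_Prefix[of P] sum_nf.intros(2)
  unfolding has_sum_nf_def by blast

lemma has_sum_nf_Choice:
  assumes "has_sum_nf P" "has_sum_nf Q"
  shows "has_sum_nf (P \<oplus> Q)"
proof -
  obtain M N where M: "sum_nf M" "derivable_F P M" and N: "sum_nf N" "derivable_F Q N"
    using assms by (auto simp: has_sum_nf_def)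
  have i: "initial M" "initial N" using M N sum_nf_initial by auto
  have PQ: "derivable_F (P \<oplus> Q) (M \<oplus> N)"
    using M N assms has_sum_nf_initial by (blast intro: derivable_F_Choice)
  \<comment> \<open>\<open>sum_nf\<close> bars \<open>Null\<close> operands, so these are removed
    with \<open>F3\<close>, after a swap with \<open>F2\<close> if they stand on the left.\<close>
  consider "N = Null" | "M = Null" | "M \<noteq> Null" "N \<noteq> Null" by blast
  then have "has_sum_nf (M \<oplus> N)"
  proof cases
    case 1
    then show ?thesis
      using has_sum_nf_trans[OF derivable_F_Null[OF i(1)] sum_nf_has_sum_nf[OF M(1)]] by simp
  next
    case 2
    then show ?thesis
      using has_sum_nf_trans[OF derivable_F_comm[OF i]]
        has_sum_nf_trans[OF derivable_F_Null[OF i(2)] sum_nf_has_sum_nf[OF N(1)]] by simp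
  next
    case 3
    then show ?thesis using M N by (intro sum_nf_has_sum_nf sum_nf.intros)
  qed
  with PQ show ?thesis by (rule has_sum_nf_trans)
qed

lemma has_sum_nf_altcomp:
  "altcomp I f S \<Longrightarrow> (\<And>i. i \<in> I \<Longrightarrow> has_sum_nf (f i)) \<Longrightarrow> has_sum_nf S"
  by (induction rule: altcomp.induct) (auto intro: has_sum_nf_Null has_sum_nf_Choice)

text \<open>One \<open>T\<close> serves all choices of marks: the unmarked instance feeds the
  induction, the marked ones are used in \<open>normalisation\<close>. The conclusion is an axiom
  instance rather than a derivation, since reachability of the left-hand side depends on the
  marks.\<close>

lemma expansion_has_sum_nf:
  assumes "sum_nf S\<^sub>1" "sum_nf S\<^sub>2"
  shows "\<exists>T. has_sum_nf T \<and> (\<forall>b b\<^sub>1 b\<^sub>2. (b \<noteq> None \<longleftrightarrow> b\<^sub>1 \<noteq> None \<or> b\<^sub>2 \<noteq> None) \<longrightarrow>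
    axiom_F (Par L (opt_past b\<^sub>1 S\<^sub>1) (opt_past b\<^sub>2 S\<^sub>2)) (opt_past b T))"
  using assms
proof (induction "size S\<^sub>1 + size S\<^sub>2" arbitrary: S\<^sub>1 S\<^sub>2 rule: less_induct)
  case less
  obtain I\<^sub>1 a\<^sub>1 P\<^sub>1 where S\<^sub>1: "altcomp I\<^sub>1 (\<lambda>i::nat. Prefix (a\<^sub>1 i) (P\<^sub>1 i)) S\<^sub>1"
    "\<And>i. i \<in> I\<^sub>1 \<Longrightarrow> sum_nf (P\<^sub>1 i)" "\<And>i. i \<in> I\<^sub>1 \<Longrightarrow> size (P\<^sub>1 i) < size S\<^sub>1"
    using sum_nf_altcomp[OF less(2)] by blast
  obtain I\<^sub>2 a\<^sub>2 P\<^sub>2 where S\<^sub>2: "altcomp I\<^sub>2 (\<lambda>i::nat. Prefix (a\<^sub>2 i) (P\<^sub>2 i)) S\<^sub>2"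
    "\<And>i. i \<in> I\<^sub>2 \<Longrightarrow> sum_nf (P\<^sub>2 i)" "\<And>i. i \<in> I\<^sub>2 \<Longrightarrow> size (P\<^sub>2 i) < size S\<^sub>2"
    using sum_nf_altcomp[OF less(3)] by blast
  \<comment> \<open>In every summand of the expansion at least one operand is replaced by a smaller
    continuation. Without marks both sides are initial, so the axiom instance is derivable.\<close>
  have IH: "has_sum_nf (Par L Q\<^sub>1 Q\<^sub>2)"
    if sz: "size Q\<^sub>1 + size Q\<^sub>2 < size S\<^sub>1 + size S\<^sub>2" and Q: "sum_nf Q\<^sub>1" "sum_nf Q\<^sub>2" for Q\<^sub>1 Q\<^sub>2
  proof -
    obtain T where T: "has_sum_nf T" "axiom_F (Par L (opt_past None Q\<^sub>1) (opt_past None Q\<^sub>2)) (opt_past None T)"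
      using less(1)[OF sz Q] by blast
    have "derivable_F (Par L Q\<^sub>1 Q\<^sub>2) T"
      using T Q by (intro derivable_F.ax) (auto simp: has_sum_nf_initial sum_nf_initial reach_initial)
    then show ?thesis using T(1) by (rule has_sum_nf_trans)
  qed
  have fin: "finite I\<^sub>1" "finite I\<^sub>2" using S\<^sub>1 S\<^sub>2 altcomp_finite by blast+
  have "finite {i \<in> I\<^sub>1. a\<^sub>1 i \<notin> sync_set L}" using fin by simp
  from altcomp_exists[OF this] obtain T\<^sub>1 where
    T\<^sub>1: "altcomp {i \<in> I\<^sub>1. a\<^sub>1 i \<notin> sync_set L} (\<lambda>i. Prefix (a\<^sub>1 i) (Par L (P\<^sub>1 i) S\<^sub>2)) T\<^sub>1" ..
  have "finite {i \<in> I\<^sub>2. a\<^sub>2 i \<notin> sync_set L}" using fin by simp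
  from altcomp_exists[OF this] obtain T\<^sub>2 where
    T\<^sub>2: "altcomp {i \<in> I\<^sub>2. a\<^sub>2 i \<notin> sync_set L} (\<lambda>i. Prefix (a\<^sub>2 i) (Par L S\<^sub>1 (P\<^sub>2 i))) T\<^sub>2" ..
  have "finite {(i, j). i \<in> I\<^sub>1 \<and> a\<^sub>1 i \<in> sync_set L \<and> j \<in> I\<^sub>2 \<and> a\<^sub>2 j = a\<^sub>1 i}"
    by (rule finite_subset[of _ "I\<^sub>1 \<times> I\<^sub>2"]) (use fin in auto)
  from altcomp_exists[OF this] obtain T\<^sub>3 where
    T\<^sub>3: "altcomp {(i, j). i \<in> I\<^sub>1 \<and> a\<^sub>1 i \<in> sync_set L \<and> j \<in> I\<^sub>2 \<and> a\<^sub>2 j = a\<^sub>1 i}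
         (\<lambda>(i, j). Prefix (a\<^sub>1 i) (Par L (P\<^sub>1 i) (P\<^sub>2 j))) T\<^sub>3" ..
  have "has_sum_nf T\<^sub>1"
    by (rule has_sum_nf_altcomp[OF T\<^sub>1]) (use S\<^sub>1 less in \<open>auto intro!: has_sum_nf_Prefix IH\<close>)
  moreover have "has_sum_nf T\<^sub>2"
    by (rule has_sum_nf_altcomp[OF T\<^sub>2]) (use S\<^sub>2 less in \<open>auto intro!: has_sum_nf_Prefix IH\<close>)
  moreover have "has_sum_nf T\<^sub>3"
    by (rule has_sum_nf_altcomp[OF T\<^sub>3])
      (use S\<^sub>1 S\<^sub>2 less in \<open>auto intro!: has_sum_nf_Prefix IH add_strict_mono\<close>)
  ultimately have "has_sum_nf (T\<^sub>1 \<oplus> T\<^sub>2 \<oplus> T\<^sub>3)" by (intro has_sum_nf_Choice)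
  then show ?case
    using axiom_F.F8[OF S\<^sub>1(1) sum_nf_F_nf[OF less(2)] S\<^sub>2(1) sum_nf_F_nf[OF less(3)] T\<^sub>1 T\<^sub>2 T\<^sub>3]
    by blast
qed

text \<open>\<open>F6\<close> and \<open>F7\<close> discard executed prefixes and initial
  alternatives next to a process that is not initial, \<open>F5\<close> renames the remaining mark
  to \<open>tau\<close>, and \<open>F8\<close> removes \<open>Par\<close>.\<close>

lemma normalisation:
  "P \<in> reach \<Longrightarrow> \<exists>N. sum_nf N \<and> derivable_F P (opt_past (exec_mark P) N)"
proof (induction P)
  case Null
  then show ?case using has_sum_nf_Null by (auto simp: exec_mark_def has_sum_nf_def)
next
  case (Prefix a P)
  then have "initial P" by simp
  then show ?case
    using Prefix(1) has_sum_nf_Prefix[of P a] by (auto simp: exec_mark_def has_sum_nf_def reach_initial)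
next
  case (Past a P)
  then have r: "P \<in> reach" by simp
  then obtain N where N: "sum_nf N" "derivable_F P (opt_past (exec_mark P) N)" using Past by blast
  have m: "exec_mark (Past a P) = Some tau" by (simp add: exec_mark_def)
  show ?case
  proof (cases "initial P")
    case True
    then have "derivable_F P N" using N by (simp add: exec_mark_def)
    then have "derivable_F (Past a P) (Past a N)"
      using derivable_F_opt_past[of P N "Some a"] by simp
    also have "derivable_F (Past a N) (Past tau N)"
      using N(1) by (auto intro!: derivable_F.ax axiom_F.F5 simp: sum_nf_initial reach_initial)
    finally show ?thesis using N m by auto
  next
    case False
    then have "derivable_F (Past a P) P" using r by (auto intro!: derivable_F.ax axiom_F.F6)
    then show ?thesis
      using N m False derivable_F.trans by (fastforce simp: exec_mark_def)
  qed
next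
  case (Choice P Q)
  \<comment> \<open>Reachability excludes the case of two sides that are not initial.\<close>
  consider "initial P" "initial Q" | "\<not> initial P" "initial Q" | "initial P" "\<not> initial Q"
    using Choice(3) by auto
  then show ?case
  proof cases
    case 1
    then have "has_sum_nf P" "has_sum_nf Q"
      using Choice by (auto simp: exec_mark_def has_sum_nf_def reach_initial)
    then show ?thesis
      using has_sum_nf_Choice[of P Q] 1 by (auto simp: exec_mark_def has_sum_nf_def)
  next
    case 2
    then have r: "P \<in> reach" using Choice(3) reach_initial by auto
    have "derivable_F (P \<oplus> Q) P" using 2 r by (auto intro!: derivable_F.ax axiom_F.F7)
    then show ?thesis using Choice(1)[OF r] 2 derivable_F.trans by (fastforce simp: exec_mark_def)
  next
    case 3
    then have r: "Q \<in> reach" using Choice(3) reach_initial by auto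
    have "derivable_F (P \<oplus> Q) (Q \<oplus> P)" using 3 r by (auto intro!: derivable_F.ax axiom_F.F2)
    also have "derivable_F (Q \<oplus> P) Q" using 3 r by (auto intro!: derivable_F.ax axiom_F.F7)
    finally show ?thesis using Choice(2)[OF r] 3 derivable_F.trans by (fastforce simp: exec_mark_def)
  qed
next
  case (Par L P Q)
  have r: "P \<in> reach" "Q \<in> reach" using reach_ParD Par(3) by auto
  obtain M where M: "sum_nf M" "derivable_F P (opt_past (exec_mark P) M)" using Par r by blast
  obtain N where N: "sum_nf N" "derivable_F Q (opt_past (exec_mark Q) N)" using Par r by blast
  let ?M = "opt_past (exec_mark P) M" and ?N = "opt_past (exec_mark Q) N"
  let ?b = "exec_mark (Par L P Q)"
  \<comment> \<open>Substituting under \<open>Par\<close> requires the new composition to be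
    reachable; the choice of \<open>tau\<close> as mark guarantees it.\<close>
  have rMN: "Par L ?M ?N \<in> reach"
    by (rule reach_Par_opt_past) (use M N in \<open>auto simp: exec_mark_def sum_nf_initial\<close>)
  obtain T where T: "has_sum_nf T" "axiom_F (Par L ?M ?N) (opt_past ?b T)"
    using expansion_has_sum_nf[OF M(1) N(1), of L] by (fastforce simp: exec_mark_def)
  obtain S where S: "sum_nf S" "derivable_F T S" using T(1) by (auto simp: has_sum_nf_def)
  have "T \<in> reach" using S derivable_F_reach by blast
  then have rT: "opt_past ?b T \<in> reach" by (cases ?b) auto
  have "derivable_F (Par L P Q) (Par L ?M ?N)"
    using M N rMN Par(3) by (auto intro: derivable_F.par)
  also have "derivable_F (Par L ?M ?N) (opt_past ?b T)"
    using T rMN rT by (auto intro: derivable_F.ax)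
  also have "derivable_F (opt_past ?b T) (opt_past ?b S)"
    using S derivable_F_opt_past by blast
  finally show ?case using S by blast
qed

section \<open>Completeness\<close>

text \<open>Read \<open>derivable_F (T \<oplus> X) T\<close> as \<open>X\<close> lying below
  \<open>T\<close>. An upper bound of two initial processes is then an upper bound of their
  choice.\<close>

lemma derivable_F_absorb_trans:
  assumes "derivable_F (T \<oplus> P) T" "derivable_F (T \<oplus> Q) T" "initial T" "initial P" "initial Q"
  shows "derivable_F (T \<oplus> (P \<oplus> Q)) T"
proof -
  have "derivable_F (T \<oplus> (P \<oplus> Q)) ((T \<oplus> P) \<oplus> Q)"
    using assms by (intro derivable_F.sym[OF derivable_F_assoc])
  also have "derivable_F ((T \<oplus> P) \<oplus> Q) (T \<oplus> Q)"
    using assms by (auto intro!: derivable_F_Choice derivable_F.refl reach_initial)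
  also note assms(2)
  finally show ?thesis .
qed

text \<open>In the same order, what lies below one operand lies below the choice, whichever side
  that operand is on.\<close>

lemma derivable_F_absorb_Choice:
  assumes "derivable_F (P \<oplus> X) P" "initial P" "initial Q" "initial X"
  shows "derivable_F ((P \<oplus> Q) \<oplus> X) (P \<oplus> Q)" and "derivable_F ((Q \<oplus> P) \<oplus> X) (Q \<oplus> P)"
proof -
  have "derivable_F ((Q \<oplus> P) \<oplus> X) (Q \<oplus> (P \<oplus> X))"
    using assms by (blast intro: derivable_F_assoc)
  also have "derivable_F (Q \<oplus> (P \<oplus> X)) (Q \<oplus> P)"
    using assms by (auto intro!: derivable_F_Choice derivable_F.refl reach_initial)
  finally show *: "derivable_F ((Q \<oplus> P) \<oplus> X) (Q \<oplus> P)" .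
  have "derivable_F ((P \<oplus> Q) \<oplus> X) ((Q \<oplus> P) \<oplus> X)"
    using assms by (auto intro!: derivable_F_Choice derivable_F_comm derivable_F.refl reach_initial)
  also note *
  also have "derivable_F (Q \<oplus> P) (P \<oplus> Q)" using assms by (blast intro: derivable_F_comm)
  finally show "derivable_F ((P \<oplus> Q) \<oplus> X) (P \<oplus> Q)" .
qed

text \<open>A derivative, given only up to \<open>fb\<close>, is traced back to a syntactic summand,
  which \<open>F4\<close> absorbs. Its continuation \<open>Q\<close> is a smaller normal form, so
  induction on size can be applied to it.\<close>

lemma deriv_sum_nf_absorbed:
  "sum_nf S \<Longrightarrow> deriv S a R \<Longrightarrow>
    \<exists>Q. sum_nf Q \<and> size Q < size S \<and> fb Q R \<and> derivable_F (S \<oplus> Prefix a Q) S"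
proof (induction rule: sum_nf.induct)
  case (2 P b)
  then show ?case
    by (intro exI[of _ P]) (auto intro: derivable_F_idem)
next
  case (3 P Q)
  have i: "initial P" "initial Q" using 3 sum_nf_initial by auto
  from 3(7) consider "deriv P a R" | "deriv Q a R" by auto
  then show ?case
  proof cases
    case 1
    then obtain X where X: "sum_nf X" "size X < size P" "fb X R" "derivable_F (P \<oplus> Prefix a X) P"
      using 3 by blast
    moreover have "derivable_F ((P \<oplus> Q) \<oplus> Prefix a X) (P \<oplus> Q)"
      using X i by (intro derivable_F_absorb_Choice) (auto simp: sum_nf_initial)
    ultimately show ?thesis by (intro exI[of _ X]) auto
  next
    case 2
    then obtain X where X: "sum_nf X" "size X < size Q" "fb X R" "derivable_F (Q \<oplus> Prefix a X) Q"
      using 3 by blast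
    moreover have "derivable_F ((P \<oplus> Q) \<oplus> Prefix a X) (P \<oplus> Q)"
      using X i by (intro derivable_F_absorb_Choice) (auto simp: sum_nf_initial)
    ultimately show ?thesis by (intro exI[of _ X]) auto
  qed
qed simp

text \<open>Reduces absorbing a sum to absorbing its prefixes one by one, each continuation being a
  derivative of \<open>S\<close>. The size bound in the premise lets the caller use an induction
  hypothesis there.\<close>

lemma sum_nf_absorb:
  assumes "sum_nf S" "initial T"
    and "\<And>a Q. sum_nf Q \<Longrightarrow> size Q < size S \<Longrightarrow> deriv S a Q \<Longrightarrow> derivable_F (T \<oplus> Prefix a Q) T"
  shows "derivable_F (T \<oplus> S) T"
  using assms(1,3)
proof (induction rule: sum_nf.induct)
  case 1
  then show ?case using assms(2) derivable_F_Null by blast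
next
  case (2 P a)
  then show ?case by (auto simp: sum_nf_initial)
next
  case (3 P Q)
  have i: "initial P" "initial Q" using 3 sum_nf_initial by auto
  show ?case
    by (rule derivable_F_absorb_trans) (use 3 i assms(2) in auto)
qed

lemma sum_nf_complete:
  fixes S T :: "'a::action proc"
  shows "sum_nf S \<Longrightarrow> sum_nf T \<Longrightarrow> fb S T \<Longrightarrow> derivable_F S T"
proof (induction "size S + size T" arbitrary: S T rule: less_induct)
  case less
  \<comment> \<open>Only the total size is fixed, so the claim covers both \<open>S\<close>
    absorbing \<open>T\<close> and \<open>T\<close> absorbing \<open>S\<close>.\<close>
  have absorb: "derivable_F (V \<oplus> U) V"
    if UV: "sum_nf U" "sum_nf V" "fb U V" "size U + size V = size S + size T"
    for U V :: "'a proc"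
  proof (rule sum_nf_absorb)
    show "sum_nf U" "initial V" using UV sum_nf_initial by auto
    fix a Q
    assume Q: "sum_nf Q" "size Q < size U" "deriv U a Q"
    then have "deriv V a Q" using UV(3) fb_iff_deriv by blast
    then obtain R where R: "sum_nf R" "size R < size V" "fb R Q" "derivable_F (V \<oplus> Prefix a R) V"
      using deriv_sum_nf_absorbed[OF UV(2)] by blast
    \<comment> \<open>Both continuations are strictly smaller than the sums they come from, so the
      induction hypothesis applies to this pair.\<close>
    have "derivable_F Q R"
      by (rule less(1)) (use Q R UV fb_sym in auto)
    then have "derivable_F (V \<oplus> Prefix a Q) (V \<oplus> Prefix a R)"
      using Q UV
      by (auto intro!: derivable_F_Choice derivable_F_Prefix derivable_F.refl
        simp: sum_nf_initial reach_initial)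
    then show "derivable_F (V \<oplus> Prefix a Q) V" using R(4) by (rule derivable_F.trans)
  qed
  have i: "initial S" "initial T" using less sum_nf_initial by auto
  have "derivable_F S (S \<oplus> T)"
    using absorb[of T S] less(2,3) fb_sym[OF less(4)] by (simp add: derivable_F.sym)
  also have "derivable_F (S \<oplus> T) (T \<oplus> S)" using i by (blast intro: derivable_F_comm)
  also have "derivable_F (T \<oplus> S) T" using absorb[of S T] less by auto
  finally show ?case .
qed

theorem theorem2:
  fixes P\<^sub>1 P\<^sub>2 :: "'a::action proc"
  assumes "P\<^sub>1 \<in> reach" and "P\<^sub>2 \<in> reach"
  shows "(P\<^sub>1, P\<^sub>2) \<in> FB_ps \<longleftrightarrow> derivable_F P\<^sub>1 P\<^sub>2"
proof
  assume "derivable_F P\<^sub>1 P\<^sub>2"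
  then show "(P\<^sub>1, P\<^sub>2) \<in> FB_ps" by (rule derivable_F_sound)
next
  assume "(P\<^sub>1, P\<^sub>2) \<in> FB_ps"
  then have P: "initial P\<^sub>1 \<longleftrightarrow> initial P\<^sub>2" "fb P\<^sub>1 P\<^sub>2" by (auto simp: FB_ps_iff)
  let ?b = "exec_mark P\<^sub>1"
  have b: "exec_mark P\<^sub>2 = ?b" using P(1) by (simp add: exec_mark_def)
  obtain N\<^sub>1 where N\<^sub>1: "sum_nf N\<^sub>1" "derivable_F P\<^sub>1 (opt_past ?b N\<^sub>1)"
    using normalisation[OF assms(1)] by blast
  obtain N\<^sub>2 where N\<^sub>2: "sum_nf N\<^sub>2" "derivable_F P\<^sub>2 (opt_past ?b N\<^sub>2)"
    using normalisation[OF assms(2)] b by auto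
  \<comment> \<open>By soundness the normal forms are bisimilar to the given processes, and
    \<open>fb\<close> ignores the mark.\<close>
  have "fb N\<^sub>1 N\<^sub>2"
    using derivable_F_fb[OF N\<^sub>1(2)] derivable_F_fb[OF N\<^sub>2(2)] P(2) fb_opt_past fb_cong fb_sym
    by metis
  then have "derivable_F (opt_past ?b N\<^sub>1) (opt_past ?b N\<^sub>2)"
    using N\<^sub>1 N\<^sub>2 by (blast intro: derivable_F_opt_past sum_nf_complete)
  then show "derivable_F P\<^sub>1 P\<^sub>2"
    using derivable_F.trans[OF derivable_F.trans[OF N\<^sub>1(2)] derivable_F.sym[OF N\<^sub>2(2)]] by blast
qed

end
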